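(* Let $p$ be a prime, and let $r, s \in \{0, 1, \dots, p-1\}$. The congruence $\binom{pa+r}{pb+s} \equiv \binom{a}{b}\binom{r}{s} \pmod{p^2}$ holds for all integers $a \geq 0$ and $b \geq 0$ if and only if $s \leq r$ and \[ \binom{r}{s} \equiv (-1)^{r-s}\binom{p-1-s}{r-s} \equiv (-1)^s \binom{p-1-r+s}{s} \pmod{p^2}. \]
   Context: Binomial coefficients $\binom{n}{k}$ with $k > n \geq 0$ are $0$. *)

theory Defs
  imports "HOL-Number_Theory.Number_Theory"
begin

end

theory Submission
  imports Defs
begin

text \<open>Write \<open>P\<^sub>n(x) = (x + 1) \<cdots> (x + n)\<close>, so that \<open>P\<^sub>n(p x) \<equiv> n! + p x E\<^sub>n\<close> modulo \<open>p\<^sup>2\<close>.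
  For \<open>s \<le> r\<close> the quotient of \<open>P\<^sub>r(p a)\<close> by \<open>P\<^sub>s(p b) P\<^bsub>r-s\<^esub>(p (a - b))\<close> relates
  \<open>pa + r\<close> choose \<open>pb + s\<close> to \<open>pa\<close> choose \<open>pb\<close>, and the latter is congruent to \<open>a\<close> choose \<open>b\<close>.
  Hence the congruence at \<open>(a, b)\<close> follows from \<open>p\<close> dividing an integer \<open>a u + b v\<close>, where
  \<open>u\<close>, \<open>v\<close> depend on \<open>r\<close>, \<open>s\<close> only, and is equivalent to it when \<open>a\<close> choose \<open>b\<close> is 1.
  It holds everywhere iff it holds at \<open>(1, 0)\<close> and \<open>(1, 1)\<close>. By linearity one may
  replace these points by \<open>(-1, 0)\<close> and \<open>(-1, -1)\<close>, where the same quotients of products are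
  the two signed binomial coefficients in the criterion. For \<open>s > r\<close> the congruence fails at \<open>(1, 0)\<close>.\<close>

section \<open>Binomial coefficients of multiples of a prime\<close>

text \<open>Absorption: \<open>m\<close> times the coefficient is a multiple of
  \<open>p * a\<close>, and the prime \<open>p\<close> does not divide \<open>m\<close>.\<close>

lemma prime_dvd_binomial_mult:
  fixes p a m :: nat
  assumes "prime p" "\<not> p dvd m"
  shows "p dvd (p * a) choose m"
proof (cases "p * a = 0")
  case True
  then show ?thesis using assms(2) by (cases m) auto
next
  case False
  obtain m' where m: "m = Suc m'" using assms(2) by (cases m) auto
  obtain n where n: "p * a = Suc n" using False by (cases "p * a") auto
  have "Suc m' * (Suc n choose Suc m') = p * (a * (n choose m'))"
    by (metis Suc_times_binomial mult.assoc n)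
  then have "p dvd m * ((p * a) choose m)" using m n by simp
  then show ?thesis using assms by (simp add: prime_dvd_mult_iff)
qed

text \<open>Vandermonde for \<open>p + p * a\<close>: for \<open>0 < k < p\<close> both factors of
  the \<open>k\<close>-th term are divisible by \<open>p\<close>, for \<open>k > p\<close> the first
  vanishes. The terms \<open>k = 0\<close> and \<open>k = p\<close> reproduce Pascal's rule.\<close>

lemma binomial_mult_prime_cong:
  fixes p a b :: nat
  assumes p: "prime p"
  shows "[(p * a) choose (p * b) = a choose b] (mod p\<^sup>2)"
proof (induction a arbitrary: b)
  case 0
  show ?case using prime_gt_0_nat[OF p] by (cases b) (auto simp: binomial_eq_0)
next
  case (Suc a)
  show ?case
  proof (cases b)
    case 0
    then show ?thesis by simp
  next
    case (Suc b')
    define f where "f k = (p choose k) * ((p * a) choose (p * b - k))" for k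
    have pb: "p \<le> p * b" "p * b - p = p * b'" using Suc by auto
    have p0: "p > 0" using prime_gt_0_nat[OF p] .
    have mid: "p\<^sup>2 dvd f k" if "k \<in> {..p * b} - {0, p}" for k
    proof (cases "k < p")
      case True
      then have k: "0 < k" "k < p" using that by auto
      then have ndvd: "\<not> p dvd k" by (auto dest: dvd_imp_le)
      have "p dvd p choose k" using prime_dvd_binomial_mult[OF p ndvd, of 1] by simp
      moreover have "\<not> p dvd p * b - k"
        using ndvd k pb by (metis dvd_diffD1 dvd_triv_left le_trans less_imp_le_nat)
      then have "p dvd (p * a) choose (p * b - k)" by (rule prime_dvd_binomial_mult[OF p])
      ultimately show ?thesis by (simp add: f_def power2_eq_square mult_dvd_mono)
    next
      case False
      then show ?thesis using that by (simp add: f_def binomial_eq_0)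
    qed
    have "(p * Suc a) choose (p * b) = (\<Sum>k\<le>p * b. f k)"
      using vandermonde[of p "p * a" "p * b"] by (simp add: f_def)
    also have "\<dots> = sum f ({..p * b} - {0, p}) + sum f {0, p}"
      using pb by (intro sum.subset_diff) auto
    also have "sum f {0, p} = ((p * a) choose (p * b)) + ((p * a) choose (p * b'))"
      using p0 pb by (simp add: f_def)
    finally have eq: "(p * Suc a) choose (p * b) = sum f ({..p * b} - {0, p})
        + (((p * a) choose (p * b)) + ((p * a) choose (p * b')))" .
    have "[sum f ({..p * b} - {0, p}) = 0] (mod p\<^sup>2)"
      unfolding cong_0_iff using mid by (rule dvd_sum)
    then have "[(p * Suc a) choose (p * b) = 0 + ((a choose b) + (a choose b'))] (mod p\<^sup>2)"
      unfolding eq by (intro cong_add Suc.IH)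
    then show ?thesis using Suc by (simp add: add.commute)
  qed
qed

section \<open>Exact product identities\<close>

lemma fact_add_pochhammer:
  "(fact (m + n) :: 'a::{comm_semiring_1, semiring_char_0}) = fact m * pochhammer (of_nat m + 1) n"
proof (induction n)
  case (Suc n)
  have "(fact (m + Suc n) :: 'a) = of_nat (m + n + 1) * fact (m + n)" by simp
  with Suc show ?case by (simp add: pochhammer_Suc algebra_simps)
qed simp

text \<open>Multiplying by \<open>fact n * fact (m - n)\<close> turns both sides into
  \<open>fact (m + r)\<close>. The form is free of division, so it can be reduced modulo
  \<open>p\<^sup>2\<close>.\<close>

lemma binomial_add_pochhammer:
  assumes "n \<le> m" "s \<le> r"
  shows "int ((m + r) choose (n + s)) * pochhammer (int n + 1) s * pochhammer (int m - int n + 1) (r - s)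
    = int (m choose n) * pochhammer (int m + 1) r"
proof -
  have choose: "fact k * fact (l - k) * int (l choose k) = fact l" if "k \<le> l" for k l :: nat
    using binomial_fact_lemma[OF that] by (metis of_nat_fact of_nat_mult)
  have "m + r - (n + s) = (m - n) + (r - s)" using assms by simp
  then have big: "fact (n + s) * fact ((m - n) + (r - s)) * int ((m + r) choose (n + s)) = fact (m + r)"
    using choose[of "n + s" "m + r"] assms by simp
  have small: "fact n * fact (m - n) * int (m choose n) = fact m"
    using choose assms by simp
  have "(fact n * fact (m - n))
      * (int ((m + r) choose (n + s)) * pochhammer (int n + 1) s * pochhammer (int m - int n + 1) (r - s))
    = fact (n + s) * fact ((m - n) + (r - s)) * int ((m + r) choose (n + s))"
    unfolding fact_add_pochhammer using assms by (simp add: of_nat_diff mult_ac)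
  also have "\<dots> = fact m * pochhammer (int m + 1) r"
    unfolding big by (rule fact_add_pochhammer)
  also have "\<dots> = (fact n * fact (m - n)) * (int (m choose n) * pochhammer (int m + 1) r)"
    unfolding small[symmetric] by (simp only: mult_ac)
  finally show ?thesis by simp
qed

text \<open>The factors of the product are the negatives of \<open>p - 1\<close>, ...,
  \<open>p - n\<close>.\<close>

lemma pochhammer_neg_mult_fact:
  assumes "n < p"
  shows "pochhammer (1 - int p) n * fact (p - 1 - n) = (- 1) ^ n * fact (p - 1)"
  using assms
proof (induction n)
  case (Suc n)
  have "p - 1 - n = Suc (p - 1 - Suc n)" using Suc.prems by simp
  then have "(fact (p - 1 - n) :: int) = (int p - 1 - int n) * fact (p - 1 - Suc n)"
    using Suc.prems by (simp add: of_nat_diff)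
  then have "pochhammer (1 - int p) (Suc n) * fact (p - 1 - Suc n)
      = - (pochhammer (1 - int p) n * fact (p - 1 - n))"
    by (simp only: pochhammer_Suc) (simp add: algebra_simps)
  with Suc show ?case by simp
qed simp

text \<open>Supplies the quotient of products at \<open>(-1, -1)\<close> and, with
  \<open>r - s\<close> in place of \<open>s\<close>, at \<open>(-1, 0)\<close>.\<close>

lemma signed_binomial_pochhammer:
  assumes "s \<le> r" "r < p"
  shows "(- 1) ^ (r - s) * int ((p - 1 - s) choose (r - s)) * pochhammer (1 - int p) s * fact (r - s)
    = pochhammer (1 - int p) r"
proof -
  have "int (fact (r - s)) * int (fact (p - 1 - s - (r - s))) * int ((p - 1 - s) choose (r - s))
      = int (fact (p - 1 - s))"
    unfolding of_nat_mult[symmetric] using assms by (subst binomial_fact_lemma) auto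
  then have c: "fact (r - s) * fact (p - 1 - r) * int ((p - 1 - s) choose (r - s)) = fact (p - 1 - s)"
    using assms by simp
  have "(- 1) ^ (r - s) * int ((p - 1 - s) choose (r - s)) * pochhammer (1 - int p) s * fact (r - s)
      * fact (p - 1 - r)
    = (- 1) ^ (r - s) * (pochhammer (1 - int p) s * fact (p - 1 - s))"
    unfolding c[symmetric] by (simp add: algebra_simps)
  also have "\<dots> = (- 1) ^ r * fact (p - 1)"
    using assms by (subst pochhammer_neg_mult_fact) (auto simp flip: power_add mult.assoc)
  also have "\<dots> = pochhammer (1 - int p) r * fact (p - 1 - r)"
    using assms by (simp only: pochhammer_neg_mult_fact)
  finally show ?thesis by simp
qed

section \<open>Expansion modulo the square of \<open>p\<close>\<close>

text \<open>\<open>E\<close> is the linear coefficient of the product; that it does not depend on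
  \<open>x\<close> is what later yields a linear form in \<open>a\<close> and
  \<open>b\<close>.\<close>

lemma pochhammer_mult_cong_square:
  fixes p :: int
  shows "\<exists>E. \<forall>x. [pochhammer (p * x + 1) n = fact n + p * x * E] (mod p\<^sup>2)"
proof (induction n)
  case 0
  show ?case by (auto intro!: exI[of _ 0])
next
  case (Suc n)
  then obtain E where E: "\<And>x. [pochhammer (p * x + 1) n = fact n + p * x * E] (mod p\<^sup>2)" by auto
  show ?case
  proof (intro exI allI)
    fix x
    have "[pochhammer (p * x + 1) (Suc n) = (fact n + p * x * E) * (p * x + 1 + int n)] (mod p\<^sup>2)"
      unfolding pochhammer_Suc using E by (intro cong_mult) auto
    also have "(fact n + p * x * E) * (p * x + 1 + int n)
        = fact (Suc n) + p * x * ((int n + 1) * E + fact n) + p\<^sup>2 * (x\<^sup>2 * E)"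
      by (simp add: algebra_simps power2_eq_square)
    also have "[\<dots> = fact (Suc n) + p * x * ((int n + 1) * E + fact n)] (mod p\<^sup>2)"
      by (simp add: cong_iff_dvd_diff)
    finally show "[pochhammer (p * x + 1) (Suc n)
        = fact (Suc n) + p * x * ((int n + 1) * E + fact n)] (mod p\<^sup>2)" .
  qed
qed

text \<open>Each factor is congruent modulo \<open>p\<close> to some \<open>i\<close> with
  \<open>0 < i < p\<close>.\<close>

lemma coprime_pochhammer_mult:
  assumes "prime p" "n < p"
  shows "coprime (pochhammer (int p * x + 1) n) (int p)"
  using assms(2)
proof (induction n)
  case (Suc n)
  have "\<not> int p dvd int p * x + (1 + int n)"
    using Suc.prems zdvd_imp_le[of "int p" "1 + int n"]
    by (subst dvd_add_right_iff) auto
  then have "coprime (int p * x + 1 + int n) (int p)"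
    using assms(1) by (metis add.assoc coprime_commute prime_imp_coprime prime_nat_int_transfer)
  with Suc show ?case by (simp add: pochhammer_Suc)
qed simp

text \<open>Expanding to first order, the constant terms cancel because \<open>fact r\<close> is
  \<open>r choose s\<close> times \<open>fact s * fact (r - s)\<close>; \<open>u\<close> and
  \<open>v\<close> collect the linear terms, with one factor \<open>p\<close> removed.\<close>

lemma pochhammer_quotient_cong_iff:
  fixes p :: int
  assumes "p \<noteq> 0" "s \<le> r"
  obtains u v :: int where
    "\<And>a b. [pochhammer (p * a + 1) r
        = int (r choose s) * (pochhammer (p * b + 1) s * pochhammer (p * (a - b) + 1) (r - s))] (mod p\<^sup>2)
      \<longleftrightarrow> p dvd a * u + b * v"
proof -
  obtain E where E: "\<And>n x. [pochhammer (p * x + 1) n = fact n + p * x * E n] (mod p\<^sup>2)"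
    using pochhammer_mult_cong_square[of p] by metis
  define c where "c = int (r choose s)"
  have c: "(fact r :: int) = c * (fact s * fact (r - s))"
    using binomial_fact_lemma[OF assms(2)] unfolding c_def
    by (metis mult.commute of_nat_fact of_nat_mult)
  define u where "u = E r - c * fact s * E (r - s)"
  define v where "v = c * fact s * E (r - s) - c * E s * fact (r - s)"
  show thesis
  proof (rule that)
    fix a b :: int
    let ?L = "pochhammer (p * a + 1) r"
    let ?R = "c * (pochhammer (p * b + 1) s * pochhammer (p * (a - b) + 1) (r - s))"
    let ?L' = "fact r + p * a * E r"
    let ?R' = "c * ((fact s + p * b * E s) * (fact (r - s) + p * (a - b) * E (r - s)))"
    have "[?L = ?R] (mod p\<^sup>2) \<longleftrightarrow> [?L' = ?R'] (mod p\<^sup>2)"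
    proof -
      have 1: "[?L = ?L'] (mod p\<^sup>2)" by (rule E)
      have 2: "[?R = ?R'] (mod p\<^sup>2)" by (intro cong_mult E cong_refl)
      show ?thesis using 1 2 by (meson cong_trans cong_sym)
    qed
    also have "\<dots> \<longleftrightarrow> p\<^sup>2 dvd ?L' - ?R'" by (rule cong_iff_dvd_diff)
    \<comment> \<open>The only quadratic term is the product of the two corrections in
      \<open>?R'\<close>.\<close>
    also have "?L' - ?R' = p * (a * u + b * v) + p\<^sup>2 * (- (c * b * (a - b) * E s * E (r - s)))"
      unfolding u_def v_def c by (simp add: algebra_simps power2_eq_square)
    also have "p\<^sup>2 dvd \<dots> \<longleftrightarrow> p\<^sup>2 dvd p * (a * u + b * v)"
      by (rule dvd_add_left_iff) simp
    also have "\<dots> \<longleftrightarrow> p dvd a * u + b * v"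
      using assms(1) by (simp add: power2_eq_square)
    finally show "[?L = int (r choose s) * (pochhammer (p * b + 1) s
        * pochhammer (p * (a - b) + 1) (r - s))] (mod p\<^sup>2) \<longleftrightarrow> p dvd a * u + b * v"
      by (simp only: c_def)
  qed
qed

section \<open>The criterion\<close>

text \<open>As \<open>r < p\<close>, the prime \<open>p\<close> occurs only once in
  \<open>fact (p + r)\<close>, which is a multiple of the coefficient.\<close>

lemma not_square_dvd_binomial:
  fixes p r s :: nat
  assumes "prime p" "r < s" "s < p"
  shows "\<not> p\<^sup>2 dvd (p + r) choose s"
proof
  assume "p\<^sup>2 dvd (p + r) choose s"
  then have "p\<^sup>2 dvd fact s * fact (p + r - s) * ((p + r) choose s)" by (rule dvd_mult)
  also have "\<dots> = fact (p + r)" using assms by (intro binomial_fact_lemma) auto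
  finally have "int (p\<^sup>2) dvd int (fact (p + r))" by (simp only: of_nat_dvd_iff)
  then have "(int p)\<^sup>2 dvd fact p * pochhammer (int p + 1) r"
    unfolding fact_add_pochhammer[symmetric] by simp
  also have "(fact p :: int) = int p * fact (p - 1)"
    using prime_gt_0_nat[OF assms(1)] by (simp add: fact_reduce)
  finally have "int p dvd fact (p - 1) * pochhammer (int p * 1 + 1) r"
    using prime_gt_0_nat[OF assms(1)] by (simp add: power2_eq_square mult.assoc)
  moreover have "coprime (fact (p - 1) * pochhammer (int p * 1 + 1) r) (int p)"
    using coprime_pochhammer_mult[OF assms(1), of "p - 1" 0]
      coprime_pochhammer_mult[OF assms(1), of r 1] assms
    by (simp add: pochhammer_fact)
  ultimately have "is_unit (int p)"
    by (metis coprime_common_divisor dvd_refl)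
  then show False using assms(1) by auto
qed

theorem theorem2:
  fixes p r s :: nat
  assumes "prime p" and "r \<in> {0..p - 1}" and "s \<in> {0..p - 1}"
  shows "(\<forall>a b :: nat. [(p * a + r) choose (p * b + s) = (a choose b) * (r choose s)] (mod p ^ 2))
    \<longleftrightarrow> s \<le> r
      \<and> [int (r choose s) = (- 1) ^ (r - s) * int ((p - 1 - s) choose (r - s))] (mod (int p) ^ 2)
      \<and> [(- 1) ^ (r - s) * int ((p - 1 - s) choose (r - s))
           = (- 1) ^ s * int ((p - 1 - r + s) choose s)] (mod (int p) ^ 2)"
proof (cases "s \<le> r")
  case False
  have "s < p" using assms(3) prime_gt_0_nat[OF assms(1)] by auto
  then have "\<not> [(p * 1 + r) choose (p * 0 + s) = (1 choose 0) * (r choose s)] (mod p ^ 2)"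
    using not_square_dvd_binomial[OF assms(1), of r s] False by (simp add: cong_0_iff binomial_eq_0)
  then show ?thesis using False by blast
next
  case sr: True
  have p0: "p > 0" using prime_gt_0_nat[OF assms(1)] .
  have rp: "r < p" using assms(2) p0 by auto
  let ?q = "int p"
  define c where "c = int (r choose s)"
  define X where "X = (- 1) ^ (r - s) * int ((p - 1 - s) choose (r - s))"
  define Y where "Y = (- 1) ^ s * int ((p - 1 - r + s) choose s)"
  \<comment> \<open>Integer arguments make the points \<open>(-1, -1)\<close> and
    \<open>(-1, 0)\<close> available.\<close>
  define D where "D a b = pochhammer (?q * b + 1) s * pochhammer (?q * (a - b) + 1) (r - s)" for a b
  define N where "N a = pochhammer (?q * a + 1) r" for a
  have D: "coprime (D a b) (?q\<^sup>2)" for a b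
    unfolding D_def using coprime_pochhammer_mult[OF assms(1)] rp sr by auto
  obtain u v where uv: "\<And>a b. [N a = c * D a b] (mod ?q\<^sup>2) \<longleftrightarrow> ?q dvd a * u + b * v"
    unfolding N_def c_def D_def using p0 sr by (auto intro: pochhammer_quotient_cong_iff[of ?q s r])
  have quotient_cong: "[z = c] (mod ?q\<^sup>2) \<longleftrightarrow> ?q dvd a * u + b * v" if "z * D a b = N a" for z a b
    using that uv[of a b] cong_mult_rcancel[OF D, of z a b c] by simp

  have "X * D (-1) (-1) = N (-1)"
    using signed_binomial_pochhammer[OF sr rp]
    by (simp add: X_def D_def N_def pochhammer_fact[symmetric] mult.assoc)
  from quotient_cong[OF this] have X: "[X = c] (mod ?q\<^sup>2) \<longleftrightarrow> ?q dvd u + v"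
    by (simp flip: dvd_minus_iff[of _ "u + v"])
  \<comment> \<open>Replacing \<open>s\<close> by \<open>r - s\<close> exchanges the two factors of
    \<open>D\<close>, which carries \<open>(-1, -1)\<close> to \<open>(-1, 0)\<close> and
    \<open>X\<close> to \<open>Y\<close>.\<close>
  have "p - 1 - (r - s) = p - 1 - r + s" using sr rp by simp
  then have "Y * D (-1) 0 = N (-1)"
    using signed_binomial_pochhammer[of "r - s" r p] sr rp
    by (simp add: Y_def D_def N_def pochhammer_fact[symmetric] mult_ac)
  from quotient_cong[OF this] have Y: "[Y = c] (mod ?q\<^sup>2) \<longleftrightarrow> ?q dvd u" by simp

  have binom: "int ((p * a + r) choose (p * b + s)) * D (int a) (int b)
      = int ((p * a) choose (p * b)) * N (int a)" if "b \<le> a" for a b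
    using binomial_add_pochhammer[of "p * b" "p * a" s r] sr that
    by (simp add: D_def N_def mult.assoc right_diff_distrib)
  have to_int: "[(p * a + r) choose (p * b + s) = (a choose b) * (r choose s)] (mod p ^ 2)
      \<longleftrightarrow> [int ((p * a + r) choose (p * b + s)) = int (a choose b) * c] (mod ?q\<^sup>2)" for a b
    unfolding c_def by (metis cong_int_iff of_nat_mult of_nat_power)

  have "(\<forall>a b :: nat. [(p * a + r) choose (p * b + s) = (a choose b) * (r choose s)] (mod p ^ 2))
      \<longleftrightarrow> ?q dvd u + v \<and> ?q dvd u" (is "?A \<longleftrightarrow> ?B")
  proof
    assume A: ?A
    \<comment> \<open>For \<open>a = 1\<close> and \<open>b \<le> 1\<close> both
      \<open>a choose b\<close> and \<open>(p * a) choose (p * b)\<close> are 1, so the coefficient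
      itself is the quotient of \<open>N\<close> by \<open>D\<close>.\<close>
    have "[int ((p * 1 + r) choose (p * b + s)) = c] (mod ?q\<^sup>2)" if "b \<le> 1" for b
      using A[unfolded to_int, rule_format, of 1 b] that by (cases b) auto
    moreover have "int ((p * 1 + r) choose (p * b + s)) * D 1 (int b) = N 1" if "b \<le> 1" for b
      using binom[OF that] that by (cases b) auto
    ultimately have "?q dvd 1 * u + int b * v" if "b \<le> 1" for b
      using quotient_cong that by blast
    from this[of 0] this[of 1] show ?B by simp
  next
    assume ?B
    then have "?q dvd u" "?q dvd v" using dvd_add_right_iff by blast+
    then have N: "[N a = c * D a b] (mod ?q\<^sup>2)" for a b unfolding uv by simp
    show ?A
    proof (intro allI)
      fix a b :: nat
      show "[(p * a + r) choose (p * b + s) = (a choose b) * (r choose s)] (mod p ^ 2)"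
      proof (cases "b \<le> a")
        case True
        have "[int ((p * a) choose (p * b)) = int (a choose b)] (mod ?q\<^sup>2)"
          using binomial_mult_prime_cong[OF assms(1), of a b] by (metis cong_int_iff of_nat_power)
        from cong_mult[OF this N[of "int a" "int b"]]
        have "[int ((p * a + r) choose (p * b + s)) * D (int a) (int b)
            = int (a choose b) * c * D (int a) (int b)] (mod ?q\<^sup>2)"
          using binom[OF True] by (simp add: mult.assoc)
        then show ?thesis unfolding to_int using cong_mult_rcancel[OF D] by blast
      next
        case False
        \<comment> \<open>For \<open>b > a\<close> both sides vanish, since
          \<open>r < p\<close>.\<close>
        then have "p * Suc a \<le> p * b" by (intro mult_le_mono2) simp
        then have "p * a + r < p * b + s" using rp by simp
        then show ?thesis using False by (simp add: binomial_eq_0)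
      qed
    qed
  qed
  also have "\<dots> \<longleftrightarrow> [c = X] (mod ?q\<^sup>2) \<and> [X = Y] (mod ?q\<^sup>2)"
    unfolding X[symmetric] Y[symmetric] by (meson cong_sym cong_trans)
  finally show ?thesis using sr by (simp add: c_def X_def Y_def)
qed

end
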